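(* Let $H$ be a nonzero complex Hilbert space with inner product $(\cdot,\cdot)$. For $g\in\mathbb{C}$ let $\psi_g:\mathbb{C}\to\mathbb{C}$ be the linear map $\psi_g(f)=(f,g)=f\overline{g}$. Let $\phi:H\times H\to L(\mathbb{C})$ be the conjugate-bilinear map defined by $$\phi(a,b)=\psi_{(a,b)}\qquad (a,b\in H).$$ Then $H$ is a Hilbert space with respect to $\phi$.
   Context: For a nonzero complex Hilbert space $K$, $L(K)$ denotes the bounded linear operators on $K$ with the operator norm, $I_K$ is the identity operator, and $S\le T$ means that $T-S$ is positive, where an operator $P$ is positive if $(Pk,k)\ge 0$ for all $k\in K$. In the claim $K=\mathbb{C}$ with inner product $(f,g)=f\overline{g}$. An $L(K)$-valued norm on a complex linear space $X$ is a function $F:X\to L(K)$ such that (1) $F(x)\ge 0$ for all $x$; (2) $F(x+y)\le F(x)+F(y)$ for all $x,y$; (3) $F(\lambda x)=|\lambda|F(x)$ for all $\lambda\in\mathbb{C}$, $x\in X$; (4) $F(x)=0$ if and only if $x=0$. A sequence $\{x_n\}$ is Cauchy with respect to $F$ if for every $\epsilon>0$ there is $N$ with $F(x_n-x_m)\le\epsilon I_K$ for all $n,m\ge N$; it converges to $x\in X$ with respect to $F$ if for every $\epsilon>0$ there is $N$ with $F(x_n-x)\le\epsilon I_K$ for all $n\ge N$. $X$ is complete with respect to $F$ if every sequence that is Cauchy with respect to $F$ converges with respect to $F$ to an element of $X$. A conjugate-bilinear map is one that is additive in each variable, linear in one of the two variables and conjugate-linear in the other. An $L(K)$-valued inner product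 on $X$ is a conjugate-bilinear map $\varphi:X\times X\to L(K)$ such that (1) $\varphi(x,x)\ge 0$ for all $x$; (2) $\varphi(x,x)=0$ if and only if $x=0$; (3) $\varphi(x,y)=\varphi(y,x)^*$ for all $x,y$. $X$ is a Hilbert space with respect to $\varphi$ if $\varphi$ is an $L(K)$-valued inner product on $X$, the function $F_\varphi(x)=[\varphi(x,x)]^{1/2}$ (positive square root) is an $L(K)$-valued norm on $X$, and $X$ is complete with respect to $F_\varphi$. *)

theory Defs
  imports "HOL-Analysis.Analysis" "HOL-Library.Complex_Order"
begin

text \<open>A complex vector space is also a real one by restriction of scalars; making this part of
  the class gives access to the library's real normed and inner product spaces.\<close>

class complex_vector = real_vector +
  fixes scaleC :: "complex \<Rightarrow> 'a \<Rightarrow> 'a"  (infixr \<open>*\<^sub>C\<close> 75)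
  assumes scaleC_add_right: "c *\<^sub>C (x + y) = c *\<^sub>C x + c *\<^sub>C y"
    and scaleC_add_left: "(c + d) *\<^sub>C x = c *\<^sub>C x + d *\<^sub>C x"
    and scaleC_scaleC: "c *\<^sub>C (d *\<^sub>C x) = (c * d) *\<^sub>C x"
    and scaleC_one: "1 *\<^sub>C x = x"
    and scaleR_scaleC: "r *\<^sub>R x = complex_of_real r *\<^sub>C x"

text \<open>The inner product is linear in its first argument. Positive definiteness, and
  \<open>norm x = sqrt (Re (cinner x x))\<close>, come from the axioms of \<open>real_inner\<close> together with
  \<open>inner_eq_Re_cinner\<close> and the Hermitian symmetry.\<close>

class complex_inner = complex_vector + real_inner +
  fixes cinner :: "'a \<Rightarrow> 'a \<Rightarrow> complex"
  assumes cinner_commute: "cinner x y = cnj (cinner y x)"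
    and cinner_add_left: "cinner (x + y) z = cinner x z + cinner y z"
    and cinner_scaleC_left: "cinner (c *\<^sub>C x) y = c * cinner x y"
    and inner_eq_Re_cinner: "inner x y = Re (cinner x y)"

class complex_hilbert_space = complex_inner + complete_space

instantiation complex :: complex_hilbert_space
begin

definition scaleC_complex :: "complex \<Rightarrow> complex \<Rightarrow> complex"
  where "scaleC_complex c z = c * z"

definition cinner_complex :: "complex \<Rightarrow> complex \<Rightarrow> complex"
  where "cinner_complex f g = f * cnj g"

instance
  by standard
    (auto simp: scaleC_complex_def cinner_complex_def algebra_simps inner_complex_def
      scaleR_conv_of_real)

end

text \<open>\<open>L(K)\<close>: the complex-linear elements of the library's type of bounded real-linear maps,
  whose algebraic operations and operator norm are the usual ones.\<close>

definition L_ops :: "('k::complex_hilbert_space \<Rightarrow>\<^sub>L 'k) set"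
  where "L_ops = {T. \<forall>c k. blinfun_apply T (c *\<^sub>C k) = c *\<^sub>C blinfun_apply T k}"

text \<open>In \<open>Complex_Order\<close>, \<open>0 \<le> z\<close> for complex \<open>z\<close> means that \<open>z\<close> is real and nonnegative.\<close>

definition positive_op :: "('k::complex_hilbert_space \<Rightarrow>\<^sub>L 'k) \<Rightarrow> bool"
  where "positive_op P \<longleftrightarrow> (\<forall>k. 0 \<le> cinner (blinfun_apply P k) k)"

definition op_le :: "('k::complex_hilbert_space \<Rightarrow>\<^sub>L 'k) \<Rightarrow> ('k \<Rightarrow>\<^sub>L 'k) \<Rightarrow> bool"
  where "op_le S T \<longleftrightarrow> positive_op (T - S)"

definition op_adjoint :: "('k::complex_hilbert_space \<Rightarrow>\<^sub>L 'k) \<Rightarrow> ('k \<Rightarrow>\<^sub>L 'k)"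
  where "op_adjoint T = (THE S. S \<in> L_ops \<and>
    (\<forall>k l. cinner (blinfun_apply T k) l = cinner k (blinfun_apply S l)))"

definition op_sqrt :: "('k::complex_hilbert_space \<Rightarrow>\<^sub>L 'k) \<Rightarrow> ('k \<Rightarrow>\<^sub>L 'k)"
  where "op_sqrt P = (THE S. S \<in> L_ops \<and> positive_op S \<and> S o\<^sub>L S = P)"

definition L_norm :: "('x::complex_vector \<Rightarrow> ('k::complex_hilbert_space \<Rightarrow>\<^sub>L 'k)) \<Rightarrow> bool"
  where "L_norm F \<longleftrightarrow>
    (\<forall>x. F x \<in> L_ops) \<and>
    (\<forall>x. op_le 0 (F x)) \<and>
    (\<forall>x y. op_le (F (x + y)) (F x + F y)) \<and>
    (\<forall>c x. F (c *\<^sub>C x) = cmod c *\<^sub>R F x) \<and>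
    (\<forall>x. F x = 0 \<longleftrightarrow> x = 0)"

definition L_Cauchy ::
  "('x::complex_vector \<Rightarrow> ('k::complex_hilbert_space \<Rightarrow>\<^sub>L 'k)) \<Rightarrow> (nat \<Rightarrow> 'x) \<Rightarrow> bool"
  where "L_Cauchy F s \<longleftrightarrow>
    (\<forall>e>0. \<exists>N. \<forall>n\<ge>N. \<forall>m\<ge>N. op_le (F (s n - s m)) (e *\<^sub>R id_blinfun))"

definition L_converges ::
  "('x::complex_vector \<Rightarrow> ('k::complex_hilbert_space \<Rightarrow>\<^sub>L 'k)) \<Rightarrow> (nat \<Rightarrow> 'x) \<Rightarrow> 'x \<Rightarrow> bool"
  where "L_converges F s x \<longleftrightarrow>
    (\<forall>e>0. \<exists>N. \<forall>n\<ge>N. op_le (F (s n - x)) (e *\<^sub>R id_blinfun))"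

definition L_complete :: "('x::complex_vector \<Rightarrow> ('k::complex_hilbert_space \<Rightarrow>\<^sub>L 'k)) \<Rightarrow> bool"
  where "L_complete F \<longleftrightarrow> (\<forall>s. L_Cauchy F s \<longrightarrow> (\<exists>x. L_converges F s x))"

text \<open>Complex multiples of operators are written pointwise, since bounded linear maps are only a
  real vector space in the library.\<close>

definition conj_bilinear ::
  "('x::complex_vector \<Rightarrow> 'x \<Rightarrow> ('k::complex_hilbert_space \<Rightarrow>\<^sub>L 'k)) \<Rightarrow> bool"
  where "conj_bilinear \<phi> \<longleftrightarrow>
    (\<forall>x y z. \<phi> (x + y) z = \<phi> x z + \<phi> y z) \<and>
    (\<forall>x y z. \<phi> x (y + z) = \<phi> x y + \<phi> x z) \<and>
    ((\<forall>c x y k. blinfun_apply (\<phi> (c *\<^sub>C x) y) k = c *\<^sub>C blinfun_apply (\<phi> x y) k \<and>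
                blinfun_apply (\<phi> x (c *\<^sub>C y)) k = cnj c *\<^sub>C blinfun_apply (\<phi> x y) k) \<or>
     (\<forall>c x y k. blinfun_apply (\<phi> (c *\<^sub>C x) y) k = cnj c *\<^sub>C blinfun_apply (\<phi> x y) k \<and>
                blinfun_apply (\<phi> x (c *\<^sub>C y)) k = c *\<^sub>C blinfun_apply (\<phi> x y) k))"

definition L_inner_product ::
  "('x::complex_vector \<Rightarrow> 'x \<Rightarrow> ('k::complex_hilbert_space \<Rightarrow>\<^sub>L 'k)) \<Rightarrow> bool"
  where "L_inner_product \<phi> \<longleftrightarrow>
    (\<forall>x y. \<phi> x y \<in> L_ops) \<and>
    conj_bilinear \<phi> \<and>
    (\<forall>x. op_le 0 (\<phi> x x)) \<and>
    (\<forall>x. \<phi> x x = 0 \<longleftrightarrow> x = 0) \<and>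
    (\<forall>x y. \<phi> x y = op_adjoint (\<phi> y x))"

definition hilbert_space_wrt ::
  "('x::complex_vector \<Rightarrow> 'x \<Rightarrow> ('k::complex_hilbert_space \<Rightarrow>\<^sub>L 'k)) \<Rightarrow> bool"
  where "hilbert_space_wrt \<phi> \<longleftrightarrow>
    L_inner_product \<phi> \<and>
    L_norm (\<lambda>x. op_sqrt (\<phi> x x)) \<and>
    L_complete (\<lambda>x. op_sqrt (\<phi> x x))"

lift_definition psi :: "complex \<Rightarrow> (complex \<Rightarrow>\<^sub>L complex)" is "\<lambda>g f. cinner f g"
  unfolding cinner_complex_def by (rule bounded_linear_mult_left)

end

theory Submission imports Defs begin

text \<open>Every element of \<open>L(\<complex>)\<close> is multiplication by a scalar, and \<open>psi g\<close> is multiplication by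
  the conjugate of \<open>g\<close>. Under \<open>g \<mapsto> psi g\<close> the operator notions therefore become scalar ones:
  composition is multiplication, positivity and the operator order are those of complex numbers,
  the adjoint is conjugation (\<open>op_adjoint_psi\<close>), and the positive square root is the square root
  of nonnegative reals (\<open>op_sqrt_psi\<close>).

  Since \<open>(x,x) = \<parallel>x\<parallel>\<^sup>2\<close>, the operator-valued norm induced by \<open>\<phi>\<close> is
  \<open>F(x) = psi \<parallel>x\<parallel>\<close> (\<open>op_sqrt_psi_cinner\<close>). So the \<open>L(\<complex>)\<close>-valued inner product, the
  \<open>L(\<complex>)\<close>-valued norm and completeness translate into the inner product, the norm and the
  completeness of \<open>H\<close>. The conjugate in \<open>psi\<close> makes \<open>\<phi>\<close> linear in its second variable and
  conjugate-linear in its first.\<close>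

lemma psi_apply: "blinfun_apply (psi g) f = f * cnj g"
  by transfer (simp add: cinner_complex_def)

lemma psi_in_L_ops: "psi g \<in> L_ops"
  by (simp add: L_ops_def psi_apply scaleC_complex_def)

text \<open>A complex-linear map of the complex numbers is determined by its value at \<open>1\<close>. This turns the
  uniqueness of adjoints and square roots into statements about scalars.\<close>

lemma L_ops_complex_eq_psi:
  assumes "T \<in> L_ops"
  obtains g where "T = psi g"
proof
  show "T = psi (cnj (blinfun_apply T 1))"
  proof (rule blinfun_eqI)
    fix k
    have "blinfun_apply T (k *\<^sub>C 1) = k *\<^sub>C blinfun_apply T 1"
      using assms by (simp add: L_ops_def)
    then show "blinfun_apply T k = blinfun_apply (psi (cnj (blinfun_apply T 1))) k"
      by (simp add: psi_apply scaleC_complex_def)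
  qed
qed

lemma psi_eq_iff: "psi g = psi h \<longleftrightarrow> g = h"
proof
  assume "psi g = psi h"
  then have "blinfun_apply (psi g) 1 = blinfun_apply (psi h) 1"
    by simp
  then show "g = h"
    by (simp add: psi_apply)
qed simp

lemma psi_zero: "psi 0 = 0"
  by (rule blinfun_eqI) (simp add: psi_apply)

lemma psi_one: "psi 1 = id_blinfun"
  by (rule blinfun_eqI) (simp add: psi_apply)

lemma psi_add: "psi (g + h) = psi g + psi h"
  by (rule blinfun_eqI) (simp add: psi_apply plus_blinfun.rep_eq algebra_simps)

lemma psi_diff: "psi (g - h) = psi g - psi h"
  by (rule blinfun_eqI) (simp add: psi_apply minus_blinfun.rep_eq algebra_simps)

lemma psi_of_real_mult: "psi (complex_of_real r * g) = r *\<^sub>R psi g"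
  by (rule blinfun_eqI) (simp add: psi_apply scaleR_blinfun.rep_eq scaleR_conv_of_real)

lemma psi_mult: "psi (g * h) = psi g o\<^sub>L psi h"
  by (rule blinfun_eqI) (simp add: psi_apply)

text \<open>The quadratic form of \<open>psi g\<close> at \<open>k\<close> is \<open>\<bar>k\<bar>\<^sup>2\<close> times the conjugate of \<open>g\<close>, and
  conjugation does not change a number that is real.\<close>

lemma positive_op_psi: "positive_op (psi g) \<longleftrightarrow> 0 \<le> g"
proof
  assume "positive_op (psi g)"
  then have "0 \<le> cinner (blinfun_apply (psi g) 1) 1"
    unfolding positive_op_def by blast
  then show "0 \<le> g"
    by (simp add: psi_apply cinner_complex_def less_eq_complex_def)
next
  assume "0 \<le> g"
  then have "0 \<le> cnj g"
    by (simp add: less_eq_complex_def)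
  moreover have "cinner (blinfun_apply (psi g) k) k = (k * cnj k) * cnj g" for k
    by (simp add: psi_apply cinner_complex_def mult_ac)
  moreover have "0 \<le> k * cnj k" for k :: complex
    by (simp add: complex_mult_cnj less_eq_complex_def)
  ultimately show "positive_op (psi g)"
    by (simp add: positive_op_def)
qed

lemma op_le_psi: "op_le (psi g) (psi h) \<longleftrightarrow> g \<le> h"
  by (simp add: op_le_def positive_op_psi flip: psi_diff)

lemma op_adjoint_psi: "op_adjoint (psi g) = psi (cnj g)"
  unfolding op_adjoint_def
proof (rule the_equality)
  show "psi (cnj g) \<in> L_ops \<and>
    (\<forall>k l. cinner (blinfun_apply (psi g) k) l = cinner k (blinfun_apply (psi (cnj g)) l))"
    by (simp add: psi_in_L_ops psi_apply cinner_complex_def)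
next
  fix S
  assume S: "S \<in> L_ops \<and>
    (\<forall>k l. cinner (blinfun_apply (psi g) k) l = cinner k (blinfun_apply S l))"
  then obtain h where h: "S = psi h"
    using L_ops_complex_eq_psi by blast
  have "cinner (blinfun_apply (psi g) 1) 1 = cinner 1 (blinfun_apply S 1)"
    using S by blast
  then show "S = psi (cnj g)"
    by (simp add: h psi_apply cinner_complex_def)
qed

text \<open>A positive operator is \<open>psi\<close> of a nonnegative real, so the uniqueness of the positive square
  root is that of real square roots.\<close>

lemma op_sqrt_psi:
  assumes "0 \<le> r"
  shows "op_sqrt (psi (complex_of_real r)) = psi (complex_of_real (sqrt r))"
  unfolding op_sqrt_def
proof (rule the_equality)
  show "psi (complex_of_real (sqrt r)) \<in> L_ops \<and> positive_op (psi (complex_of_real (sqrt r))) \<and>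
    psi (complex_of_real (sqrt r)) o\<^sub>L psi (complex_of_real (sqrt r)) = psi (complex_of_real r)"
    using assms
    by (simp add: psi_in_L_ops positive_op_psi less_eq_complex_def flip: psi_mult of_real_mult)
next
  fix S
  assume S: "S \<in> L_ops \<and> positive_op S \<and> S o\<^sub>L S = psi (complex_of_real r)"
  then obtain g where g: "S = psi g"
    using L_ops_complex_eq_psi by blast
  have "0 \<le> g"
    using S by (simp add: g positive_op_psi)
  then have real: "g = complex_of_real (Re g)" and nonneg: "0 \<le> Re g"
    by (simp_all add: less_eq_complex_def complex_eq_iff)
  have "g * g = complex_of_real r"
    using S by (simp add: g psi_eq_iff flip: psi_mult)
  then have "Re g * Re g = r"
    using real by (metis of_real_eq_iff of_real_mult)
  then have "sqrt r = Re g"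
    using nonneg by auto
  then show "S = psi (complex_of_real (sqrt r))"
    using g real by simp
qed

lemma cinner_self: "cinner x x = complex_of_real ((norm x)\<^sup>2)"
  for x :: "'a::complex_inner"
proof -
  have "Im (cinner x x) = 0"
    using cinner_commute[of x x] by (simp add: complex_eq_iff)
  then show ?thesis
    by (simp add: complex_eq_iff power2_norm_eq_inner inner_eq_Re_cinner)
qed

lemma cinner_add_right: "cinner x (y + z) = cinner x y + cinner x z"
  for x :: "'a::complex_inner"
  by (metis cinner_add_left cinner_commute complex_cnj_add)

lemma cinner_scaleC_right: "cinner x (c *\<^sub>C y) = cnj c * cinner x y"
  for x :: "'a::complex_inner"
  by (metis cinner_scaleC_left cinner_commute complex_cnj_mult)

lemma norm_scaleC: "norm (c *\<^sub>C x) = cmod c * norm x"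
  for x :: "'a::complex_inner"
proof -
  have "complex_of_real ((norm (c *\<^sub>C x))\<^sup>2) = c * cnj c * complex_of_real ((norm x)\<^sup>2)"
    unfolding cinner_self[symmetric] by (simp add: cinner_scaleC_left cinner_scaleC_right)
  also have "\<dots> = complex_of_real ((cmod c * norm x)\<^sup>2)"
    by (simp add: power_mult_distrib flip: complex_norm_square)
  finally have "(norm (c *\<^sub>C x))\<^sup>2 = (cmod c * norm x)\<^sup>2"
    by (simp only: of_real_eq_iff)
  then show ?thesis
    by simp
qed

lemma op_sqrt_psi_cinner: "op_sqrt (psi (cinner x x)) = psi (complex_of_real (norm x))"
  for x :: "'a::complex_inner"
  unfolding cinner_self by (subst op_sqrt_psi) simp_all

lemma L_inner_product_psi_cinner:
  "L_inner_product (\<lambda>a b :: 'a::complex_inner. psi (cinner a b))"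
  unfolding L_inner_product_def
proof (intro conjI allI)
  show "conj_bilinear (\<lambda>a b :: 'a. psi (cinner a b))"
    unfolding conj_bilinear_def
    by (auto simp: cinner_add_left cinner_add_right psi_add psi_apply cinner_scaleC_left
        cinner_scaleC_right scaleC_complex_def)
next
  fix x y :: 'a
  show "psi (cinner x y) \<in> L_ops"
    by (rule psi_in_L_ops)
  show "op_le 0 (psi (cinner x x))"
    by (simp add: op_le_psi cinner_self less_eq_complex_def flip: psi_zero)
  show "psi (cinner x x) = 0 \<longleftrightarrow> x = 0"
    by (simp add: psi_eq_iff cinner_self flip: psi_zero)
  show "psi (cinner x y) = op_adjoint (psi (cinner y x))"
    by (simp add: op_adjoint_psi flip: cinner_commute)
qed

lemma L_norm_psi_norm: "L_norm (\<lambda>x :: 'a::complex_inner. psi (complex_of_real (norm x)))"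
  unfolding L_norm_def
  by (auto simp: psi_in_L_ops op_le_psi psi_eq_iff norm_scaleC norm_triangle_ineq
      less_eq_complex_def simp flip: psi_zero psi_add psi_of_real_mult)

lemma op_le_psi_scaleR_id: "op_le (psi (complex_of_real r)) (e *\<^sub>R id_blinfun) \<longleftrightarrow> r \<le> e"
proof -
  have "e *\<^sub>R id_blinfun = psi (complex_of_real e)"
    using psi_of_real_mult[of e 1] by (simp add: psi_one)
  then show ?thesis
    by (simp add: op_le_psi less_eq_complex_def)
qed

text \<open>The bounds \<open>F(s\<^sub>n - s\<^sub>m) \<le> \<epsilon> I\<close> say \<open>\<parallel>s\<^sub>n - s\<^sub>m\<parallel> \<le> \<epsilon>\<close>, so both notions of a Cauchy sequence
  agree; the strictness of the inequality does not matter as \<open>\<epsilon>\<close> varies.\<close>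

lemma L_complete_psi_norm:
  "L_complete (\<lambda>x :: 'a::complex_hilbert_space. psi (complex_of_real (norm x)))"
  unfolding L_complete_def
proof (intro allI impI)
  fix s :: "nat \<Rightarrow> 'a"
  assume s: "L_Cauchy (\<lambda>x. psi (complex_of_real (norm x))) s"
  have "Cauchy s"
  proof (rule CauchyI)
    fix e :: real
    assume "0 < e"
    \<comment> \<open>Halving \<open>e\<close> turns the non-strict bound into a strict one.\<close>
    then obtain N where "\<forall>n\<ge>N. \<forall>m\<ge>N. norm (s n - s m) \<le> e / 2"
      using s unfolding L_Cauchy_def op_le_psi_scaleR_id by (meson half_gt_zero)
    then show "\<exists>M. \<forall>m\<ge>M. \<forall>n\<ge>M. norm (s m - s n) < e"
      using \<open>0 < e\<close> by (smt (verit) field_sum_of_halves)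
  qed
  then obtain x where "s \<longlonglongrightarrow> x"
    using Cauchy_convergent convergent_def by blast
  then have "L_converges (\<lambda>x. psi (complex_of_real (norm x))) s x"
    unfolding L_converges_def op_le_psi_scaleR_id by (meson LIMSEQ_D less_imp_le)
  then show "\<exists>x. L_converges (\<lambda>x. psi (complex_of_real (norm x))) s x" ..
qed

theorem theorem3p6:
  fixes \<phi> :: "'h::complex_hilbert_space \<Rightarrow> 'h \<Rightarrow> (complex \<Rightarrow>\<^sub>L complex)"
  assumes nonzero: "\<exists>a::'h. a \<noteq> 0"
    and phi: "\<And>a b. \<phi> a b = psi (cinner a b)"
  shows "hilbert_space_wrt \<phi>"
proof -
  have "\<phi> = (\<lambda>a b. psi (cinner a b))"
    by (intro ext) (rule phi)
  then show ?thesis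
    unfolding hilbert_space_wrt_def
    by (simp add: op_sqrt_psi_cinner L_inner_product_psi_cinner L_norm_psi_norm
        L_complete_psi_norm)
qed

end
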